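(* Let $P$ be a pack for $PS$, and let $s := \sum_{ij \in P} a_{ij}$. Then $$\sum_{i \in M_P} \sum_{j \in N_i} a_{ij} x_{ij} + \sum_{ij \in P,\; i \in M_P \setminus M_0} (b-s)\, x_{ij} \leq b + (|M_P \setminus M_0| - 1) (b-s)$$ is a valid inequality for $PS$. Furthermore, when $P$ is a maximal switching pack: (1) this inequality induces a face of $PS$ of dimension at least $d - |M_P \setminus M_0|$; (2) when $M_P \cap M_0 \neq \emptyset$, this inequality is facet-defining for $PS$.
   Context: Let $M=\{1,\dots,m\}$, $N_i=\{1,\dots,n_i\}$ for $i\in M$, $I=\{(i,j)\mid i\in M, j\in N_i\}$ (the pair $(i,j)$ is also written $ij$), $d=\sum_{i\in M} n_i$, and let $b\in\mathbb{R}_+$, $a_{ij}\in\mathbb{R}_+$ for $ij\in I$. Let $S$ be the set of $x\in[0,1]^d$ (with coordinates $x_{ij}$, $ij\in I$) satisfying $\sum_{i\in M}\sum_{j\in N_i}a_{ij}x_{ij}\le b$ and $x_{ij}\cdot x_{ij'}=0$ for all $i\in M$, $j\ne j'\in N_i$. The complementarity knapsack polytope is $PS=\operatorname{conv}(S)$. Let $M_0=\{i\in M\mid n_i=1\}$. Standing assumptions: $M\ne M_0$; $\sum_{i\in M}\max\{a_{i1},\dots,a_{in_i}\}>b$; $b>0$ and $a_{ij}\ge 0$ for all $ij\in I$; $a_{i1}\ge\dots\ge a_{in_i}$ for all $i\in M\setminus M_0$. For $T\subseteq I$, $M_T=\{i\in M\mid ij\in T\text{ for some } j\in N_i\}$.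 A pack is a set $P=\{i_1j_1,\dots,i_kj_k\}\subset I$ with $i_1,\dots,i_k$ all distinct and $\sum_{ij\in P}a_{ij}<b$. A pack $P$ is a maximal switching pack if $j=n_i$ for every $ij\in P$, and $\sum_{ij\in P}a_{ij}-a_{i'n_{i'}}+a_{i',n_{i'}-1}>b$ for every $i'\in M_P\setminus M_0$.
   Formalization: (1) is claimed only if M_P∖M_0≠∅ or a_ij=0 for all ij∈P; (2) only if |M_P∖M_0|=1, or exactly one ij∈P with i∈M_0 has a_ij>0, or M_P∖M_0≠∅ and some ij∈P with i∈M_0 has a_ij>0; each part is false in the excluded cases. *)

theory Defs
  imports "HOL-Analysis.Analysis"
begin

definition ckp_rows :: "nat \<Rightarrow> nat set" where
  "ckp_rows m = {1..m}"

definition ckp_cols :: "(nat \<Rightarrow> nat) \<Rightarrow> nat \<Rightarrow> nat set" where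
  "ckp_cols n i = {1..n i}"

definition ckp_index :: "nat \<Rightarrow> (nat \<Rightarrow> nat) \<Rightarrow> (nat \<times> nat) set" where
  "ckp_index m n = {(i, j). i \<in> ckp_rows m \<and> j \<in> ckp_cols n i}"

definition ckp_dim :: "nat \<Rightarrow> (nat \<Rightarrow> nat) \<Rightarrow> nat" where
  "ckp_dim m n = (\<Sum>i\<in>ckp_rows m. n i)"

definition singleton_rows :: "nat \<Rightarrow> (nat \<Rightarrow> nat) \<Rightarrow> nat set" where
  "singleton_rows m n = {i \<in> ckp_rows m. n i = 1}"

text \<open>
  The ambient space is \<open>real ^ 'k\<close>, whose coordinates are labelled by the index pairs through a
  bijection \<open>\<iota>\<close> from \<open>'k\<close> onto \<open>ckp_index m n\<close> (so \<open>CARD('k) = ckp_dim m n\<close>).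
  \<open>entry \<iota> x (i, j)\<close> is the coordinate \<open>x\<close> with subscript \<open>ij\<close>.
\<close>

definition entry :: "('k::finite \<Rightarrow> nat \<times> nat) \<Rightarrow> real ^ 'k \<Rightarrow> nat \<times> nat \<Rightarrow> real" where
  "entry \<iota> x p = x $ inv \<iota> p"

definition ckp_set ::
  "('k::finite \<Rightarrow> nat \<times> nat) \<Rightarrow> nat \<Rightarrow> (nat \<Rightarrow> nat) \<Rightarrow> (nat \<times> nat \<Rightarrow> real) \<Rightarrow> real \<Rightarrow> (real ^ 'k) set" where
  "ckp_set \<iota> m n a b =
     {x. (\<forall>p\<in>ckp_index m n. 0 \<le> entry \<iota> x p \<and> entry \<iota> x p \<le> 1) \<and>
         (\<Sum>i\<in>ckp_rows m. \<Sum>j\<in>ckp_cols n i. a (i, j) * entry \<iota> x (i, j)) \<le> b \<and>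
         (\<forall>i\<in>ckp_rows m. \<forall>j\<in>ckp_cols n i. \<forall>j'\<in>ckp_cols n i.
            j \<noteq> j' \<longrightarrow> entry \<iota> x (i, j) * entry \<iota> x (i, j') = 0)}"

definition ckp_polytope ::
  "('k::finite \<Rightarrow> nat \<times> nat) \<Rightarrow> nat \<Rightarrow> (nat \<Rightarrow> nat) \<Rightarrow> (nat \<times> nat \<Rightarrow> real) \<Rightarrow> real \<Rightarrow> (real ^ 'k) set" where
  "ckp_polytope \<iota> m n a b = convex hull (ckp_set \<iota> m n a b)"

definition rows_of :: "nat \<Rightarrow> (nat \<Rightarrow> nat) \<Rightarrow> (nat \<times> nat) set \<Rightarrow> nat set" where
  "rows_of m n T = {i \<in> ckp_rows m. \<exists>j\<in>ckp_cols n i. (i, j) \<in> T}"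

definition is_pack ::
  "nat \<Rightarrow> (nat \<Rightarrow> nat) \<Rightarrow> (nat \<times> nat \<Rightarrow> real) \<Rightarrow> real \<Rightarrow> (nat \<times> nat) set \<Rightarrow> bool" where
  "is_pack m n a b P \<longleftrightarrow> P \<subseteq> ckp_index m n \<and> inj_on fst P \<and> (\<Sum>p\<in>P. a p) < b"

definition maximal_switching_pack ::
  "nat \<Rightarrow> (nat \<Rightarrow> nat) \<Rightarrow> (nat \<times> nat \<Rightarrow> real) \<Rightarrow> real \<Rightarrow> (nat \<times> nat) set \<Rightarrow> bool" where
  "maximal_switching_pack m n a b P \<longleftrightarrow>
     is_pack m n a b P \<and>
     (\<forall>(i, j)\<in>P. j = n i) \<and>
     (\<forall>i\<in>rows_of m n P - singleton_rows m n.
        (\<Sum>p\<in>P. a p) - a (i, n i) + a (i, n i - 1) > b)"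

definition pack_lhs ::
  "('k::finite \<Rightarrow> nat \<times> nat) \<Rightarrow> nat \<Rightarrow> (nat \<Rightarrow> nat) \<Rightarrow> (nat \<times> nat \<Rightarrow> real) \<Rightarrow> real \<Rightarrow>
   (nat \<times> nat) set \<Rightarrow> real ^ 'k \<Rightarrow> real" where
  "pack_lhs \<iota> m n a b P x =
     (\<Sum>i\<in>rows_of m n P. \<Sum>j\<in>ckp_cols n i. a (i, j) * entry \<iota> x (i, j)) +
     (\<Sum>p\<in>{p \<in> P. fst p \<in> rows_of m n P - singleton_rows m n}.
        (b - (\<Sum>q\<in>P. a q)) * entry \<iota> x p)"

text \<open>The subtraction of 1 is over the reals: the cardinality may be 0.\<close>

definition pack_rhs ::
  "nat \<Rightarrow> (nat \<Rightarrow> nat) \<Rightarrow> (nat \<times> nat \<Rightarrow> real) \<Rightarrow> real \<Rightarrow> (nat \<times> nat) set \<Rightarrow> real" where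
  "pack_rhs m n a b P =
     b + (real (card (rows_of m n P - singleton_rows m n)) - 1) * (b - (\<Sum>q\<in>P. a q))"

definition pack_face ::
  "('k::finite \<Rightarrow> nat \<times> nat) \<Rightarrow> nat \<Rightarrow> (nat \<Rightarrow> nat) \<Rightarrow> (nat \<times> nat \<Rightarrow> real) \<Rightarrow> real \<Rightarrow>
   (nat \<times> nat) set \<Rightarrow> (real ^ 'k) set" where
  "pack_face \<iota> m n a b P =
     {x \<in> ckp_polytope \<iota> m n a b. pack_lhs \<iota> m n a b P x = pack_rhs m n a b P}"

text \<open>The elements of a pack in rows of size one whose weight is nonzero.\<close>

definition positive_singletons ::
  "nat \<Rightarrow> (nat \<Rightarrow> nat) \<Rightarrow> (nat \<times> nat \<Rightarrow> real) \<Rightarrow> (nat \<times> nat) set \<Rightarrow> (nat \<times> nat) set" where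
  "positive_singletons m n a P = {p \<in> P. fst p \<in> singleton_rows m n \<and> a p > 0}"

end

theory Submission
  imports Defs
begin

text \<open>
  Write \<open>K\<close> for the rows of \<open>P\<close> of size at least two and \<open>c = b - s > 0\<close>. Validity on \<open>S\<close>: if some row of
  \<open>K\<close> has \<open>P\<close>-entry zero, the knapsack constraint bounds the first sum by \<open>b\<close> and the second by
  \<open>(card K - 1) * c\<close>; otherwise complementarity kills all entries of the pack rows outside \<open>P\<close> and the
  left-hand side is at most \<open>s + card K * c\<close>, the same number.

  For the dimension, the orthogonal complement of the directions of the face is determined. The
  indicator of \<open>P\<close> is tight and has slack \<open>c\<close>, so a normal \<open>\<alpha>\<close> vanishes outside the pack rows. For
  \<open>i \<in> K\<close> and \<open>j < n i\<close>, the entry \<open>(i, n i)\<close> may be switched to a fractional entry \<open>(i, j)\<close> filling the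
  knapsack exactly; the switching condition leaves room to trade this entry against a pack entry
  in a row of size one. Hence on row \<open>i\<close> and on the rows of size one, \<open>\<alpha>\<close> is \<open>\<mu> i\<close> times the
  coefficients of the inequality, which leaves \<open>card K\<close> degrees of freedom, and a single one if
  some row of size one carries positive weight.
\<close>

section \<open>Dimension of a set through its normals\<close>

text \<open>The dimensions of \<open>V\<close> and its orthogonal complement add up to that of the
  space, and the complement lies in \<open>span W\<close>. Bounding the normals replaces exhibiting
  affinely independent points of \<open>F\<close>.\<close>

lemma aff_dim_ge_if_normals_in_span:
  fixes F :: "'a::euclidean_space set"
  assumes "x0 \<in> F" and "finite W"
    and normals: "\<And>\<alpha>. (\<And>x y. x \<in> F \<Longrightarrow> y \<in> F \<Longrightarrow> \<alpha> \<bullet> x = \<alpha> \<bullet> y) \<Longrightarrow> \<alpha> \<in> span W"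
  shows "aff_dim F \<ge> int DIM('a) - int (card W)"
proof -
  define V where "V = span ((+) (- x0) ` F)"
  have "{y \<in> UNIV. \<forall>x\<in>V. orthogonal x y} \<subseteq> span W"
  proof clarify
    fix \<alpha> assume orth: "\<forall>x\<in>V. orthogonal x \<alpha>"
    have "\<alpha> \<bullet> x = \<alpha> \<bullet> x0" if "x \<in> F" for x
    proof -
      have "- x0 + x \<in> V"
        unfolding V_def using that by (intro span_base imageI)
      then have "(x - x0) \<bullet> \<alpha> = 0"
        using orth by (simp add: orthogonal_def)
      then show ?thesis
        by (simp add: inner_diff_left inner_commute[of \<alpha>])
    qed
    then show "\<alpha> \<in> span W"
      by (intro normals) simp
  qed
  then have "dim {y \<in> UNIV. \<forall>x\<in>V. orthogonal x y} \<le> card W"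
    using assms(2) by (rule dim_le_card)
  moreover have "dim {y \<in> UNIV. \<forall>x\<in>V. orthogonal x y} + dim V = dim (UNIV :: 'a set)"
    by (rule dim_subspace_orthogonal_to_vectors) (auto simp: V_def)
  moreover have "aff_dim F = int (dim V)"
    unfolding V_def dim_span using assms(1) by (intro aff_dim_eq_dim hull_inc)
  ultimately show ?thesis
    by simp
qed

section \<open>Coordinates and the linear form of the inequality\<close>

definition vec_of :: "('k::finite \<Rightarrow> nat \<times> nat) \<Rightarrow> (nat \<times> nat \<Rightarrow> real) \<Rightarrow> real ^ 'k" where
  "vec_of \<iota> f = (\<chi> k. f (\<iota> k))"

text \<open>At most one entry per row is nonzero, so complementarity holds by construction. All
  points of the face used below have this shape.\<close>

definition choice_pt ::
  "('k::finite \<Rightarrow> nat \<times> nat) \<Rightarrow> (nat \<Rightarrow> nat) \<Rightarrow> (nat \<Rightarrow> real) \<Rightarrow> real ^ 'k" where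
  "choice_pt \<iota> \<pi> v = vec_of \<iota> (\<lambda>(i, j). if j = \<pi> i then v i else 0)"

locale complementarity_knapsack =
  fixes \<iota> :: "'k::finite \<Rightarrow> nat \<times> nat"
    and m :: nat and n :: "nat \<Rightarrow> nat"
    and a :: "nat \<times> nat \<Rightarrow> real" and b :: real
    and P :: "(nat \<times> nat) set"
  assumes bij: "bij_betw \<iota> UNIV (ckp_index m n)"
    and n_ge_1: "\<forall>i\<in>ckp_rows m. n i \<ge> 1"
    and b_pos: "b > 0"
    and a_nonneg: "\<forall>p\<in>ckp_index m n. a p \<ge> 0"
    and a_antimono: "\<forall>i\<in>ckp_rows m - singleton_rows m n. \<forall>j\<in>ckp_cols n i. \<forall>j'\<in>ckp_cols n i.
           j \<le> j' \<longrightarrow> a (i, j) \<ge> a (i, j')"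
    and pack: "is_pack m n a b P"
begin

abbreviation "I \<equiv> ckp_index m n"
abbreviation "M \<equiv> ckp_rows m"
abbreviation "R \<equiv> rows_of m n P"
abbreviation "K \<equiv> rows_of m n P - singleton_rows m n"
abbreviation "s \<equiv> \<Sum>q\<in>P. a q"
abbreviation "F \<equiv> pack_face \<iota> m n a b P"

text \<open>The normal vector of the inequality, its two sums collected per coordinate.\<close>

definition coef :: "nat \<times> nat \<Rightarrow> real" where
  "coef p = (if fst p \<in> R then a p else 0) + (if p \<in> P \<and> fst p \<in> K then b - s else 0)"

lemma index_eq_Sigma: "I = Sigma M (ckp_cols n)"
  by (auto simp: ckp_index_def)

lemma finite_rows [simp]: "finite M"
  by (simp add: ckp_rows_def)

lemma finite_cols [simp]: "finite (ckp_cols n i)"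
  by (simp add: ckp_cols_def)

lemma finite_index [simp]: "finite I"
  by (simp add: index_eq_Sigma)

lemma P_subset: "P \<subseteq> I" and inj_P: "inj_on fst P" and s_less_b: "s < b"
  using pack by (auto simp: is_pack_def)

lemma finite_P [simp]: "finite P"
  using P_subset finite_index by (rule finite_subset)

lemma rows_of_eq: "R = fst ` P"
  using P_subset by (force simp: rows_of_def ckp_index_def)

lemma rows_subset: "R \<subseteq> M"
  by (auto simp: rows_of_def)

lemma finite_R [simp]: "finite R"
  by (simp add: rows_of_eq)

lemma card_index: "CARD('k) = ckp_dim m n"
  using bij_betw_same_card[OF bij] by (simp add: index_eq_Sigma ckp_dim_def ckp_cols_def)

lemma entry_iota [simp]: "entry \<iota> x (\<iota> k) = x $ k"
  using bij by (simp add: entry_def bij_betw_def)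

lemma entry_vec_of [simp]: "p \<in> I \<Longrightarrow> entry \<iota> (vec_of \<iota> f) p = f p"
  using bij by (simp add: entry_def vec_of_def bij_betw_def f_inv_into_f)

lemma vec_of_entry: "vec_of \<iota> (entry \<iota> x) = x"
  by (simp add: vec_of_def vec_eq_iff)

lemma inner_vec_of: "vec_of \<iota> w \<bullet> x = (\<Sum>p\<in>I. w p * entry \<iota> x p)"
proof -
  have "vec_of \<iota> w \<bullet> x = (\<Sum>k\<in>UNIV. w (\<iota> k) * entry \<iota> x (\<iota> k))"
    by (simp add: inner_vec_def vec_of_def)
  also have "\<dots> = (\<Sum>p\<in>I. w p * entry \<iota> x p)"
    using bij by (rule sum.reindex_bij_betw)
  finally show ?thesis .
qed

lemma sum_index: "(\<Sum>p\<in>I. f p) = (\<Sum>i\<in>M. \<Sum>j\<in>ckp_cols n i. f (i, j))"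
  unfolding index_eq_Sigma by (simp add: sum.Sigma)

lemma vec_of_in_span_singleton:
  assumes "\<And>p. p \<in> I \<Longrightarrow> entry \<iota> x p = r * f p"
  shows "x \<in> span {vec_of \<iota> f}"
proof -
  have "x $ k = r * f (\<iota> k)" for k
    using assms[of "\<iota> k"] bij by (auto simp: bij_betw_def)
  then have "x = r *\<^sub>R vec_of \<iota> f"
    by (simp add: vec_eq_iff vec_of_def)
  then show ?thesis
    by (auto simp: span_singleton)
qed

lemma pack_lhs_eq_inner: "pack_lhs \<iota> m n a b P x = vec_of \<iota> coef \<bullet> x"
proof -
  have "(\<Sum>i\<in>R. \<Sum>j\<in>ckp_cols n i. a (i, j) * entry \<iota> x (i, j))
      = (\<Sum>i\<in>M. if i \<in> R then \<Sum>j\<in>ckp_cols n i. a (i, j) * entry \<iota> x (i, j) else 0)"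
    using rows_subset by (simp add: sum.If_cases Int_absorb1)
  also have "\<dots> = (\<Sum>p\<in>I. (if fst p \<in> R then a p else 0) * entry \<iota> x p)"
    unfolding sum_index by (intro sum.cong) (auto simp: sum.neutral)
  finally have 1: "(\<Sum>i\<in>R. \<Sum>j\<in>ckp_cols n i. a (i, j) * entry \<iota> x (i, j)) = \<dots>" .
  have "(\<Sum>p\<in>{p \<in> P. fst p \<in> K}. (b - s) * entry \<iota> x p)
      = (\<Sum>p\<in>I. if p \<in> {p \<in> P. fst p \<in> K} then (b - s) * entry \<iota> x p else 0)"
    using P_subset by (intro sum.mono_neutral_cong_left) auto
  also have "\<dots> = (\<Sum>p\<in>I. (if p \<in> P \<and> fst p \<in> K then b - s else 0) * entry \<iota> x p)"
    by (intro sum.cong) auto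
  finally show ?thesis
    unfolding pack_lhs_def 1 inner_vec_of coef_def distrib_right sum.distrib by simp
qed

section \<open>Validity of the inequality\<close>

lemma pack_inequality_on_set:
  assumes x: "x \<in> ckp_set \<iota> m n a b"
  shows "pack_lhs \<iota> m n a b P x \<le> pack_rhs m n a b P"
proof -
  let ?x = "entry \<iota> x"
  let ?Q = "{p \<in> P. fst p \<in> K}"
  have bnd: "0 \<le> ?x p" "?x p \<le> 1" "0 \<le> a p" if "p \<in> I" for p
    using x a_nonneg that by (auto simp: ckp_set_def)
  have load: "(\<Sum>i\<in>M. \<Sum>j\<in>ckp_cols n i. a (i, j) * ?x (i, j)) \<le> b"
    using x by (simp add: ckp_set_def)
  have compl: "?x (i, j) * ?x (i, j') = 0"
    if "i \<in> M" "j \<in> ckp_cols n i" "j' \<in> ckp_cols n i" "j \<noteq> j'" for i j j'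
    using x that by (auto simp: ckp_set_def)
  \<comment> \<open>A pack has at most one entry in each row, so \<open>?Q\<close> has one element
    per row of \<open>K\<close>.\<close>
  have "K = fst ` ?Q"
    by (auto simp: rows_of_eq)
  then have "card K = card (fst ` ?Q)"
    by (rule arg_cong)
  also have "\<dots> = card ?Q"
    by (rule card_image, rule inj_on_subset[OF inj_P]) auto
  finally have card_Q: "card ?Q = card K" ..
  show ?thesis
  proof (cases "\<exists>q\<in>?Q. ?x q = 0")
    case True
    then obtain q where q: "q \<in> ?Q" "?x q = 0"
      by blast
    have "(\<Sum>i\<in>R. \<Sum>j\<in>ckp_cols n i. a (i, j) * ?x (i, j))
        \<le> (\<Sum>i\<in>M. \<Sum>j\<in>ckp_cols n i. a (i, j) * ?x (i, j))"
      using rows_subset bnd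
      by (intro sum_mono2) (auto intro!: sum_nonneg simp: index_eq_Sigma)
    moreover have "(\<Sum>p\<in>?Q. (b - s) * ?x p) \<le> (real (card K) - 1) * (b - s)"
    proof -
      have "(\<Sum>p\<in>?Q. (b - s) * ?x p) = (\<Sum>p\<in>?Q - {q}. (b - s) * ?x p)"
        using q by (subst sum.remove[of _ q]) auto
      also have "\<dots> \<le> (\<Sum>p\<in>?Q - {q}. b - s)"
        using bnd P_subset s_less_b by (intro sum_mono mult_left_le) auto
      also have "\<dots> = (real (card K) - 1) * (b - s)"
      proof -
        have "finite ?Q"
          by simp
        then have "real (card ?Q) = 1 + real (card (?Q - {q}))"
          using card.remove[of ?Q q] q(1) by simp
        then show ?thesis
          using card_Q by simp
      qed
      finally show ?thesis .
    qed
    ultimately show ?thesis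
      using load unfolding pack_lhs_def pack_rhs_def by linarith
  next
    case False
    have row: "(\<Sum>j\<in>ckp_cols n i. a (i, j) * ?x (i, j)) \<le> a (i, k)" if "(i, k) \<in> P" for i k
    proof -
      have ik: "(i, k) \<in> I" "i \<in> M" "k \<in> ckp_cols n i" "i \<in> R"
        using that P_subset by (auto simp: index_eq_Sigma rows_of_eq intro: rev_image_eqI)
      \<comment> \<open>In a row of \<open>K\<close> the nonzero pack entry kills the others; a row
        outside \<open>K\<close> has the single column \<open>k\<close>.\<close>
      have "?x (i, j) = 0" if "j \<in> ckp_cols n i" "j \<noteq> k" for j
      proof (cases "i \<in> K")
        case True
        then have "?x (i, k) \<noteq> 0"
          using False \<open>(i, k) \<in> P\<close> by auto
        then show ?thesis
          using compl[of i j k] that ik by auto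
      next
        case False
        then have "n i = 1"
          using ik by (auto simp: singleton_rows_def)
        then show ?thesis
          using that ik by (auto simp: ckp_cols_def)
      qed
      then have "(\<Sum>j\<in>ckp_cols n i. a (i, j) * ?x (i, j)) = a (i, k) * ?x (i, k)"
        using ik by (subst sum.remove[of _ k]) (auto intro!: sum.neutral)
      then show ?thesis
        using bnd[OF ik(1)] by (simp add: mult_left_le)
    qed
    have "(\<Sum>i\<in>R. \<Sum>j\<in>ckp_cols n i. a (i, j) * ?x (i, j)) \<le> s"
      unfolding rows_of_eq sum.reindex[OF inj_P] by (intro sum_mono) (auto intro: row)
    moreover have "(\<Sum>p\<in>?Q. (b - s) * ?x p) \<le> (\<Sum>p\<in>?Q. b - s)"
      using bnd P_subset s_less_b by (intro sum_mono mult_left_le) auto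
    ultimately show ?thesis
      unfolding pack_lhs_def pack_rhs_def using card_Q by (simp add: algebra_simps)
  qed
qed

lemma pack_inequality_valid:
  assumes "x \<in> ckp_polytope \<iota> m n a b"
  shows "vec_of \<iota> coef \<bullet> x \<le> pack_rhs m n a b P"
proof -
  have "ckp_polytope \<iota> m n a b \<subseteq> {x. vec_of \<iota> coef \<bullet> x \<le> pack_rhs m n a b P}"
    unfolding ckp_polytope_def using pack_inequality_on_set
    by (intro hull_minimal convex_halfspace_le) (auto simp: pack_lhs_eq_inner)
  then show ?thesis
    using assms by auto
qed

lemma pack_face_face_of: "F face_of ckp_polytope \<iota> m n a b"
proof -
  have "F = ckp_polytope \<iota> m n a b \<inter> {x. vec_of \<iota> coef \<bullet> x = pack_rhs m n a b P}"
    by (auto simp: pack_face_def pack_lhs_eq_inner)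
  also have "\<dots> face_of ckp_polytope \<iota> m n a b"
    using pack_inequality_valid
    by (intro face_of_Int_supporting_hyperplane_le) (auto simp: ckp_polytope_def)
  finally show ?thesis .
qed

section \<open>Points with one active column per row\<close>

lemma inner_choice_pt:
  assumes "\<And>i. i \<in> M \<Longrightarrow> \<pi> i \<in> ckp_cols n i"
  shows "vec_of \<iota> w \<bullet> choice_pt \<iota> \<pi> v = (\<Sum>i\<in>M. w (i, \<pi> i) * v i)"
proof -
  have "vec_of \<iota> w \<bullet> choice_pt \<iota> \<pi> v
      = (\<Sum>i\<in>M. \<Sum>j\<in>ckp_cols n i. w (i, j) * (if j = \<pi> i then v i else 0))"
    unfolding choice_pt_def inner_vec_of sum_index by (intro sum.cong refl) (simp add: index_eq_Sigma)
  also have "\<dots> = (\<Sum>i\<in>M. w (i, \<pi> i) * v i)"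
    using assms by (intro sum.cong refl) (simp add: if_distrib cong: if_cong)
  finally show ?thesis .
qed

lemma choice_pt_in_set:
  assumes "\<And>i. i \<in> M \<Longrightarrow> \<pi> i \<in> ckp_cols n i"
    and "\<And>i. i \<in> M \<Longrightarrow> 0 \<le> v i \<and> v i \<le> 1"
    and "(\<Sum>i\<in>M. a (i, \<pi> i) * v i) \<le> b"
  shows "choice_pt \<iota> \<pi> v \<in> ckp_set \<iota> m n a b"
proof -
  have ent: "entry \<iota> (choice_pt \<iota> \<pi> v) (i, j) = (if j = \<pi> i then v i else 0)"
    if "i \<in> M" "j \<in> ckp_cols n i" for i j
    using that by (simp add: choice_pt_def index_eq_Sigma)
  have "(\<Sum>i\<in>M. \<Sum>j\<in>ckp_cols n i. a (i, j) * entry \<iota> (choice_pt \<iota> \<pi> v) (i, j)) \<le> b"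
    using assms(3) inner_choice_pt[OF assms(1), of a v]
    by (simp add: inner_vec_of sum_index)
  then show ?thesis
    using assms(2) by (auto simp: ckp_set_def ent index_eq_Sigma)
qed

lemma zero_in_polytope: "0 \<in> ckp_polytope \<iota> m n a b"
  unfolding ckp_polytope_def using b_pos
  by (intro hull_inc) (simp add: ckp_set_def entry_def)

text \<open>Tight points arise below from one base point by changing single rows; this rule computes
  the load, the left-hand side and the value of a normal alike.\<close>

lemma choice_sum_upd:
  assumes "i \<in> M"
  shows "(\<Sum>k\<in>M. w (k, (\<pi>(i := j)) k) * (v(i := t)) k)
    = (\<Sum>k\<in>M. w (k, \<pi> k) * v k) - w (i, \<pi> i) * v i + (w (i, j) * t :: real)"
  using assms by (simp add: sum.remove[of M i])

end

section \<open>Maximal switching packs and their indicator\<close>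

locale maximal_switching = complementarity_knapsack \<iota> m n a b P
  for \<iota> :: "'k::finite \<Rightarrow> nat \<times> nat" and m n a b P +
  assumes msp: "maximal_switching_pack m n a b P"
begin

lemma P_eq: "P = (\<lambda>i. (i, n i)) ` R"
  using msp by (force simp: maximal_switching_pack_def rows_of_eq)

lemma in_P_iff: "(i, j) \<in> P \<longleftrightarrow> i \<in> R \<and> j = n i"
  by (subst P_eq) auto

lemma n_in_cols: "i \<in> M \<Longrightarrow> n i \<in> ckp_cols n i"
  using n_ge_1 by (auto simp: ckp_cols_def)

lemma sum_P: "(\<Sum>q\<in>P. f q) = (\<Sum>i\<in>R. f (i, n i))"
  by (subst P_eq) (simp add: sum.reindex inj_on_def)

lemma a_n_nonneg: "i \<in> M \<Longrightarrow> 0 \<le> a (i, n i)"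
  using a_nonneg n_in_cols by (auto simp: index_eq_Sigma)

text \<open>The switching condition concerns column \<open>n i - 1\<close>; weights do not increase
  along the row, so it carries over to every earlier column.\<close>

lemma switch_greater:
  assumes "i \<in> K" and "j \<in> ckp_cols n i" and "j \<noteq> n i"
  shows "a (i, j) > b - s + a (i, n i)"
proof -
  have i: "i \<in> M - singleton_rows m n"
    using assms(1) rows_subset by auto
  have "j \<le> n i - 1" "n i - 1 \<in> ckp_cols n i"
    using assms(2,3) by (auto simp: ckp_cols_def)
  then have "a (i, j) \<ge> a (i, n i - 1)"
    using a_antimono i assms(2) by blast
  moreover have "s - a (i, n i) + a (i, n i - 1) > b"
    using msp assms(1) by (simp add: maximal_switching_pack_def)
  ultimately show ?thesis
    by simp
qed

text \<open>All pack entries sit in last columns, so \<open>choice_pt \<iota> n one\<close> is the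
  indicator of \<open>P\<close>, the base point of all perturbations.\<close>

abbreviation "one \<equiv> (\<lambda>i. if i \<in> R then 1 else 0 :: real)"

lemma load_one: "(\<Sum>k\<in>M. a (k, n k) * one k) = s"
  using rows_subset by (simp add: sum_P if_distrib sum.If_cases Int_absorb1 cong: if_cong)

text \<open>Each row of \<open>K\<close> adds \<open>b - s\<close> to the load \<open>s\<close>, and
  \<open>s + card K * (b - s)\<close> is the right-hand side: the indicator is tight.\<close>

lemma coef_one: "(\<Sum>k\<in>M. coef (k, n k) * one k) = pack_rhs m n a b P"
proof -
  have "(\<Sum>k\<in>M. coef (k, n k) * one k) = (\<Sum>k\<in>R. coef (k, n k))"
    using rows_subset by (simp add: if_distrib sum.If_cases Int_absorb1 cong: if_cong)
  also have "\<dots> = (\<Sum>k\<in>R. a (k, n k) + (if k \<in> K then b - s else 0))"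
    by (intro sum.cong) (auto simp: coef_def in_P_iff)
  also have "\<dots> = s + real (card K) * (b - s)"
  proof -
    have "R \<inter> {k. k \<in> K} = K"
      by blast
    then show ?thesis
      unfolding sum.distrib sum_P[symmetric] by (subst sum.If_cases) (simp_all)
  qed
  finally show ?thesis
    by (simp add: pack_rhs_def algebra_simps)
qed

lemma choice_pt_in_face:
  assumes "\<And>i. i \<in> M \<Longrightarrow> \<pi> i \<in> ckp_cols n i"
    and "\<And>i. i \<in> M \<Longrightarrow> 0 \<le> v i \<and> v i \<le> 1"
    and "(\<Sum>i\<in>M. a (i, \<pi> i) * v i) \<le> b"
    and "(\<Sum>i\<in>M. coef (i, \<pi> i) * v i) = pack_rhs m n a b P"
  shows "choice_pt \<iota> \<pi> v \<in> F"
proof -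
  have "choice_pt \<iota> \<pi> v \<in> ckp_polytope \<iota> m n a b"
    unfolding ckp_polytope_def using assms(1-3) by (intro hull_inc choice_pt_in_set)
  then show ?thesis
    using inner_choice_pt[OF assms(1), of coef v] assms(4)
    by (simp add: pack_face_def pack_lhs_eq_inner)
qed

lemma indicator_in_face: "choice_pt \<iota> n one \<in> F"
  using s_less_b
  by (intro choice_pt_in_face) (auto simp: n_in_cols load_one coef_one)

section \<open>Normals to the face\<close>

text \<open>Membership in the orthogonal complement of the direction space of \<open>F\<close>; the
  zero vector counts.\<close>

definition normal_to_face :: "real ^ 'k \<Rightarrow> bool" where
  "normal_to_face \<alpha> \<longleftrightarrow> (\<forall>x\<in>F. \<forall>y\<in>F. \<alpha> \<bullet> x = \<alpha> \<bullet> y)"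

text \<open>Each tight feasible choice, compared with the indicator, yields one linear equation for
  the entries of \<alpha>.\<close>

lemma normal_choice_sum_eq:
  assumes "normal_to_face \<alpha>"
    and "\<And>i. i \<in> M \<Longrightarrow> \<pi> i \<in> ckp_cols n i"
    and "\<And>i. i \<in> M \<Longrightarrow> 0 \<le> v i \<and> v i \<le> 1"
    and "(\<Sum>i\<in>M. a (i, \<pi> i) * v i) \<le> b"
    and "(\<Sum>i\<in>M. coef (i, \<pi> i) * v i) = pack_rhs m n a b P"
  shows "(\<Sum>i\<in>M. entry \<iota> \<alpha> (i, \<pi> i) * v i) = (\<Sum>i\<in>M. entry \<iota> \<alpha> (i, n i) * one i)"
proof -
  have "\<alpha> \<bullet> choice_pt \<iota> \<pi> v = \<alpha> \<bullet> choice_pt \<iota> n one"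
    using assms(1) choice_pt_in_face[OF assms(2-5)] indicator_in_face
    unfolding normal_to_face_def by blast
  then show ?thesis
    using inner_choice_pt[OF assms(2), of "entry \<iota> \<alpha>" v]
      inner_choice_pt[OF n_in_cols, of "entry \<iota> \<alpha>" one]
    by (simp add: vec_of_entry)
qed

text \<open>The indicator has slack \<open>b - s\<close> and \<open>coef\<close> vanishes off the
  pack rows, so a small positive entry there keeps the point feasible and tight.\<close>

lemma normal_outside_rows:
  assumes \<alpha>: "normal_to_face \<alpha>" and p: "(i, j) \<in> I" "i \<notin> R"
  shows "entry \<iota> \<alpha> (i, j) = 0"
proof -
  \<comment> \<open>The minimum keeps the entry at most 1, the quotient keeps its load within the
    slack, and \<open>+ 1\<close> covers weight zero.\<close>
  define t where "t = min 1 ((b - s) / (a (i, j) + 1))"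
  have i: "i \<in> M" "j \<in> ckp_cols n i" and a0: "a (i, j) \<ge> 0"
    using p a_nonneg by (auto simp: index_eq_Sigma)
  have t: "0 < t" "t \<le> 1"
    using a0 s_less_b by (auto simp: t_def)
  have "a (i, j) * t \<le> a (i, j) * ((b - s) / (a (i, j) + 1))"
    using a0 by (intro mult_left_mono) (auto simp: t_def)
  also have "\<dots> \<le> b - s"
    using a0 s_less_b by (simp add: field_simps)
  finally have "a (i, j) * t \<le> b - s" .
  then have "(\<Sum>k\<in>M. entry \<iota> \<alpha> (k, (n(i := j)) k) * (one(i := t)) k)
      = (\<Sum>k\<in>M. entry \<iota> \<alpha> (k, n k) * one k)"
    using t i p
    by (intro normal_choice_sum_eq[OF \<alpha>])
       (simp_all only: choice_sum_upd[OF i(1)] load_one coef_one, auto simp: n_in_cols coef_def)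
  then show ?thesis
    unfolding choice_sum_upd[OF i(1)] using p t by simp
qed

text \<open>Deleting a weightless pack entry in a row of size one changes neither the load nor the
  left-hand side.\<close>

lemma normal_zero_weight:
  assumes \<alpha>: "normal_to_face \<alpha>" and l: "l \<in> R" "l \<in> singleton_rows m n" "a (l, n l) = 0"
  shows "entry \<iota> \<alpha> (l, n l) = 0"
proof -
  have lM: "l \<in> M"
    using l rows_subset by auto
  have "(\<Sum>k\<in>M. entry \<iota> \<alpha> (k, (n(l := n l)) k) * (one(l := 0)) k)
      = (\<Sum>k\<in>M. entry \<iota> \<alpha> (k, n k) * one k)"
    using l s_less_b
    by (intro normal_choice_sum_eq[OF \<alpha>])
       (simp_all only: choice_sum_upd[OF lM] load_one coef_one, auto simp: n_in_cols coef_def)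
  then show ?thesis
    unfolding choice_sum_upd[OF lM] using l by simp
qed

text \<open>Column \<open>n i\<close> is exchanged for column \<open>j\<close>. The coefficient lost
  is \<open>b - s + a (i, n i)\<close>, and regaining it at \<open>j\<close> means filling the
  knapsack to exactly \<open>b\<close>; by \<open>switch_greater\<close> the new entry stays below
  1.\<close>

lemma normal_switched_entry:
  assumes \<alpha>: "normal_to_face \<alpha>" and i: "i \<in> K" and j: "j \<in> ckp_cols n i" "j \<noteq> n i"
  shows "entry \<iota> \<alpha> (i, n i) * a (i, j) = entry \<iota> \<alpha> (i, j) * (b - s + a (i, n i))"
proof -
  define t where "t = (b - s + a (i, n i)) / a (i, j)"
  have iM: "i \<in> M" "i \<in> R"
    using i rows_subset by auto
  have gr: "a (i, j) > b - s + a (i, n i)" "b - s + a (i, n i) > 0"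
    using switch_greater[OF i j] a_n_nonneg[OF iM(1)] s_less_b by auto
  then have t: "0 \<le> t" "t \<le> 1" and at: "a (i, j) * t = b - s + a (i, n i)"
    by (auto simp: t_def field_simps)
  have "(\<Sum>k\<in>M. entry \<iota> \<alpha> (k, (n(i := j)) k) * (one(i := t)) k)
      = (\<Sum>k\<in>M. entry \<iota> \<alpha> (k, n k) * one k)"
    using t iM i j at
    by (intro normal_choice_sum_eq[OF \<alpha>])
       (simp_all only: choice_sum_upd[OF iM(1)] load_one coef_one, auto simp: n_in_cols coef_def in_P_iff)
  then have "entry \<iota> \<alpha> (i, n i) = entry \<iota> \<alpha> (i, j) * t"
    unfolding choice_sum_upd[OF iM(1)] using iM by simp
  then have "entry \<iota> \<alpha> (i, n i) * a (i, j) = entry \<iota> \<alpha> (i, j) * (a (i, j) * t)"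
    by simp
  then show ?thesis
    unfolding at .
qed

text \<open>After the switch in row \<open>i\<close> the entry in column \<open>j\<close> is still
  below 1. Lowering the entry of row \<open>l\<close> by \<delta> and raising that one by the same
  weight keeps the load and the left-hand side.\<close>

lemma normal_singleton_entry:
  assumes \<alpha>: "normal_to_face \<alpha>" and i: "i \<in> K" and l: "l \<in> R" "l \<in> singleton_rows m n"
  shows "entry \<iota> \<alpha> (l, n l) * (b - s + a (i, n i)) = entry \<iota> \<alpha> (i, n i) * a (l, n l)"
proof -
  define j where "j = n i - 1"
  have iM: "i \<in> M" "i \<in> R" and lM: "l \<in> M" and li: "l \<noteq> i" "i \<noteq> l"
    using i l rows_subset by auto
  have "n i \<noteq> 1" "n i \<ge> 1"
    using i iM n_ge_1 by (auto simp: singleton_rows_def)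
  then have j: "j \<in> ckp_cols n i" "j \<noteq> n i"
    by (auto simp: j_def ckp_cols_def)
  have gr: "a (i, j) > b - s + a (i, n i)" "b - s + a (i, n i) > 0"
    using switch_greater[OF i j] a_n_nonneg[OF iM(1)] s_less_b by auto
  have al: "a (l, n l) \<ge> 0"
    by (rule a_n_nonneg[OF lM])
  \<comment> \<open>Small enough for \<open>t \<le> 1\<close>; \<open>+ 1\<close> again covers
    weight zero.\<close>
  define \<delta> where "\<delta> = min 1 ((a (i, j) - (b - s + a (i, n i))) / (a (l, n l) + 1))"
  define t where "t = (b - s + a (i, n i) + a (l, n l) * \<delta>) / a (i, j)"
  have \<delta>: "0 < \<delta>" "\<delta> \<le> 1"
    using gr al by (auto simp: \<delta>_def)
  have "a (l, n l) * \<delta> \<le> a (l, n l) * ((a (i, j) - (b - s + a (i, n i))) / (a (l, n l) + 1))"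
    using al by (intro mult_left_mono) (auto simp: \<delta>_def)
  also have "\<dots> \<le> a (i, j) - (b - s + a (i, n i))"
    using al gr by (simp add: field_simps)
  finally have "b - s + a (i, n i) + a (l, n l) * \<delta> \<le> a (i, j)"
    by simp
  moreover have "0 \<le> a (l, n l) * \<delta>"
    using al \<delta> by simp
  ultimately have t: "0 \<le> t" "t \<le> 1"
    and at: "a (i, j) * t = b - s + a (i, n i) + a (l, n l) * \<delta>"
    using gr by (auto simp: t_def)
  have "(\<Sum>k\<in>M. entry \<iota> \<alpha> (k, ((n(l := n l))(i := j)) k) * ((one(l := 1 - \<delta>))(i := t)) k)
      = (\<Sum>k\<in>M. entry \<iota> \<alpha> (k, n k) * one k)"
    using t \<delta> iM i j l li at
    by (intro normal_choice_sum_eq[OF \<alpha>])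
       (simp_all only: choice_sum_upd[OF iM(1)] choice_sum_upd[OF lM] load_one coef_one,
        auto simp: n_in_cols coef_def in_P_iff algebra_simps)
  then have "entry \<iota> \<alpha> (i, j) * t = entry \<iota> \<alpha> (i, n i) + entry \<iota> \<alpha> (l, n l) * \<delta>"
    unfolding choice_sum_upd[OF iM(1)] choice_sum_upd[OF lM] using iM l li
    by (simp add: algebra_simps)
  then have "entry \<iota> \<alpha> (i, j) * (a (i, j) * t)
      = (entry \<iota> \<alpha> (i, n i) + entry \<iota> \<alpha> (l, n l) * \<delta>) * a (i, j)"
    by simp
  \<comment> \<open>The equation of the plain switch cancels the contribution of
    \<open>(i, n i)\<close>; its second use below eliminates the entry at
    \<open>(i, j)\<close>.\<close>
  then have "entry \<iota> \<alpha> (i, j) * a (l, n l) * \<delta> = entry \<iota> \<alpha> (l, n l) * a (i, j) * \<delta>"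
    unfolding at using normal_switched_entry[OF \<alpha> i j] by algebra
  then have "entry \<iota> \<alpha> (i, j) * a (l, n l) = entry \<iota> \<alpha> (l, n l) * a (i, j)"
    using \<delta> by simp
  then have "entry \<iota> \<alpha> (l, n l) * (b - s + a (i, n i)) * a (i, j)
      = entry \<iota> \<alpha> (i, n i) * a (l, n l) * a (i, j)"
    using normal_switched_entry[OF \<alpha> i j] by algebra
  then show ?thesis
    using gr by simp
qed

text \<open>For \<open>i\<close> in \<open>K\<close> the denominator is
  \<open>coef (i, n i)\<close>, so this is the ratio of \<alpha> to \<open>coef\<close> at the pack
  entry.\<close>

definition multiplier :: "real ^ 'k \<Rightarrow> nat \<Rightarrow> real" where
  "multiplier \<alpha> i = entry \<iota> \<alpha> (i, n i) / (b - s + a (i, n i))"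

text \<open>The two exchange relations express all these entries through the one at
  \<open>(i, n i)\<close>. A row of size one is tied to every \<open>i\<close> in \<open>K\<close>
  at once.\<close>

lemma normal_eq_multiplier_coef:
  assumes \<alpha>: "normal_to_face \<alpha>" and i: "i \<in> K" and p: "(k, j) \<in> I"
    and k: "k = i \<or> k \<in> R \<inter> singleton_rows m n"
  shows "entry \<iota> \<alpha> (k, j) = multiplier \<alpha> i * coef (k, j)"
proof -
  have "i \<in> M"
    using i rows_subset by auto
  then have pos: "b - s + a (i, n i) > 0"
    using a_n_nonneg s_less_b by fastforce
  consider "k = i" "j = n i" | "k = i" "j \<noteq> n i" | "k \<noteq> i" "k \<in> R \<inter> singleton_rows m n"
    using k by blast
  then show ?thesis
  proof cases
    case 1
    then show ?thesis
      using pos i by (simp add: multiplier_def coef_def in_P_iff add.commute)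
  next
    case 2
    then have "entry \<iota> \<alpha> (i, n i) * a (i, j) = entry \<iota> \<alpha> (i, j) * (b - s + a (i, n i))"
      using p by (intro normal_switched_entry \<alpha> i) (auto simp: index_eq_Sigma)
    then show ?thesis
      using pos i 2 by (simp add: multiplier_def coef_def in_P_iff field_simps)
  next
    case 3
    then have "n k = 1" "j = n k"
      using p by (auto simp: singleton_rows_def index_eq_Sigma ckp_cols_def)
    then show ?thesis
      using pos 3 normal_singleton_entry[OF \<alpha> i, of k]
      by (simp add: multiplier_def coef_def in_P_iff field_simps)
  qed
qed

lemma coef_outside_rows: "i \<notin> R \<Longrightarrow> coef (i, j) = 0"
  by (simp add: coef_def in_P_iff)

section \<open>Dimension of the face and the facet property\<close>

lemma aff_dim_face_ge:
  assumes "finite W" and "\<And>\<alpha>. normal_to_face \<alpha> \<Longrightarrow> \<alpha> \<in> span W" and "card W \<le> r"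
  shows "aff_dim F \<ge> int (ckp_dim m n) - int r"
proof -
  have "aff_dim F \<ge> int DIM(real ^ 'k) - int (card W)"
    using indicator_in_face assms(1)
    by (rule aff_dim_ge_if_normals_in_span) (rule assms(2),
      unfold normal_to_face_def, blast)
  then show ?thesis
    using assms(3) by (simp add: card_index)
qed

text \<open>If \<open>K\<close> is empty, \<open>coef\<close> agrees with \<open>a\<close> on
  \<open>P\<close>: a positive weight would put the face in a hyperplane, while with zero weights
  all normals vanish. Otherwise one vector per row of \<open>K\<close> spans the normals.\<close>

lemma aff_dim_face_general:
  assumes "K \<noteq> {} \<or> (\<forall>p\<in>P. a p = 0)"
  shows "aff_dim F \<ge> int (ckp_dim m n) - int (card K)"
proof (cases "K = {}")
  case True
  then have zero: "\<forall>p\<in>P. a p = 0"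
    using assms by simp
  have "\<alpha> \<in> span {}" if \<alpha>: "normal_to_face \<alpha>" for \<alpha>
  proof -
    have "entry \<iota> \<alpha> (i, j) = 0" if p: "(i, j) \<in> I" for i j
    proof (cases "i \<in> R")
      case iR: True
      then have "i \<in> singleton_rows m n"
        using True by auto
      moreover from this have "j = n i"
        using p by (auto simp: singleton_rows_def index_eq_Sigma ckp_cols_def)
      ultimately show ?thesis
        using normal_zero_weight[OF \<alpha> iR] zero iR by (simp add: in_P_iff)
    qed (rule normal_outside_rows[OF \<alpha> p])
    then have "\<alpha> \<in> span {vec_of \<iota> (\<lambda>_. 0)}"
      by (intro vec_of_in_span_singleton[where r = 0]) auto
    moreover have "vec_of \<iota> (\<lambda>_. 0) = 0"
      by (simp add: vec_of_def vec_eq_iff)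
    ultimately show ?thesis
      by simp
  qed
  then show ?thesis
    by (intro aff_dim_face_ge[where W = "{}"]) auto
next
  case False
  then obtain i0 where i0: "i0 \<in> K"
    by blast
  have fin: "finite K"
    by simp
  \<comment> \<open>\<open>coef\<close> restricted to row \<open>i\<close>; the rows of size one are
    attached to the single row \<open>i0\<close>, so that they are counted once.\<close>
  define w where "w i = vec_of \<iota> (\<lambda>p. if fst p = i \<or> i = i0 \<and> fst p \<in> R \<inter> singleton_rows m n
    then coef p else 0)" for i
  have "\<alpha> \<in> span (w ` K)" if \<alpha>: "normal_to_face \<alpha>" for \<alpha>
  proof -
    have "\<alpha> $ k = (\<Sum>i\<in>K. multiplier \<alpha> i *\<^sub>R w i) $ k" for k
    proof -
      obtain i j where ij: "\<iota> k = (i, j)"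
        by fastforce
      then have p: "(i, j) \<in> I"
        using bij by (metis UNIV_I bij_betwE)
      have \<alpha>k: "\<alpha> $ k = entry \<iota> \<alpha> (i, j)"
        by (simp flip: ij)
      have sum: "(\<Sum>i\<in>K. multiplier \<alpha> i *\<^sub>R w i) $ k = (\<Sum>h\<in>K. multiplier \<alpha> h *
          (if i = h \<or> h = i0 \<and> i \<in> R \<inter> singleton_rows m n then coef (i, j) else 0))"
        by (simp add: w_def vec_of_def ij cong: if_cong)
      consider "i \<in> K" | "i \<in> R \<inter> singleton_rows m n" | "i \<notin> R"
        by blast
      then show ?thesis
      proof cases
        case 1
        then have "(\<Sum>i\<in>K. multiplier \<alpha> i *\<^sub>R w i) $ k
            = (\<Sum>h\<in>K. if i = h then multiplier \<alpha> h * coef (i, j) else 0)"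
          unfolding sum by (intro sum.cong) auto
        then show ?thesis
          using normal_eq_multiplier_coef[OF \<alpha> 1 p] 1 fin by (simp add: \<alpha>k)
      next
        case 2
        then have "(\<Sum>i\<in>K. multiplier \<alpha> i *\<^sub>R w i) $ k
            = (\<Sum>h\<in>K. if i0 = h then multiplier \<alpha> h * coef (i, j) else 0)"
          unfolding sum by (intro sum.cong) auto
        then show ?thesis
          using normal_eq_multiplier_coef[OF \<alpha> i0 p] 2 i0 fin by (simp add: \<alpha>k)
      next
        case 3
        then show ?thesis
          unfolding sum \<alpha>k using normal_outside_rows[OF \<alpha> p] coef_outside_rows[of i j]
          by (auto intro!: sum.neutral)
      qed
    qed
    then have "\<alpha> = (\<Sum>i\<in>K. multiplier \<alpha> i *\<^sub>R w i)"
      unfolding vec_eq_iff by blast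
    also have "\<dots> \<in> span (w ` K)"
      by (intro span_sum span_scale span_base imageI)
    finally show ?thesis .
  qed
  then show ?thesis
    by (intro aff_dim_face_ge[where W = "w ` K"]) (auto intro: card_image_le)
qed

lemma in_positive_singletons_iff:
  "(l, j) \<in> positive_singletons m n a P \<longleftrightarrow>
    l \<in> R \<inter> singleton_rows m n \<and> j = n l \<and> a (l, n l) > 0"
  by (auto simp: positive_singletons_def in_P_iff)

text \<open>One vector spans the normals: there is a single multiplier, or all multipliers agree, or
  only one entry of \<alpha> can be nonzero.\<close>

lemma aff_dim_face_codim_1:
  assumes "card K = 1 \<or> card (positive_singletons m n a P) = 1 \<or>
    K \<noteq> {} \<and> positive_singletons m n a P \<noteq> {}"
  shows "aff_dim F \<ge> int (ckp_dim m n) - 1"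
proof -
  consider "card K = 1" | "K \<noteq> {}" "positive_singletons m n a P \<noteq> {}"
    | "K = {}" "card (positive_singletons m n a P) = 1"
    using assms by fastforce
  then show ?thesis
  proof cases
    case 1
    then show ?thesis
      using aff_dim_face_general by fastforce
  next
    case 2
    then obtain i0 q where i0: "i0 \<in> K" and q: "q \<in> positive_singletons m n a P"
      by blast
    then obtain l where l: "l \<in> R \<inter> singleton_rows m n" "a (l, n l) > 0"
      using in_positive_singletons_iff by (cases q) blast
    have lI: "(l, n l) \<in> I"
      using l rows_subset n_in_cols by (auto simp: index_eq_Sigma)
    have cl: "coef (l, n l) = a (l, n l)"
      using l by (simp add: coef_def)
    have "\<alpha> \<in> span {vec_of \<iota> coef}" if \<alpha>: "normal_to_face \<alpha>" for \<alpha>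
    proof -
      \<comment> \<open>Either multiplier times the positive weight \<open>a (l, n l)\<close> is the
        entry of \<alpha> at \<open>(l, n l)\<close>.\<close>
      have mult: "multiplier \<alpha> i = multiplier \<alpha> i0" if "i \<in> K" for i
        using normal_eq_multiplier_coef[OF \<alpha> that lI] normal_eq_multiplier_coef[OF \<alpha> i0 lI] l
        by (simp add: cl)
      have "entry \<iota> \<alpha> (i, j) = multiplier \<alpha> i0 * coef (i, j)" if p: "(i, j) \<in> I" for i j
      proof -
        consider "i \<in> K" | "i \<in> R \<inter> singleton_rows m n" | "i \<notin> R"
          by blast
        then show ?thesis
        proof cases
          case 1
          then show ?thesis
            using normal_eq_multiplier_coef[OF \<alpha> 1 p] mult by simp
        next
          case 2
          then show ?thesis
            by (intro normal_eq_multiplier_coef[OF \<alpha> i0 p]) simp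
        next
          case 3
          then show ?thesis
            using normal_outside_rows[OF \<alpha> p] coef_outside_rows by simp
        qed
      qed
      then show ?thesis
        by (intro vec_of_in_span_singleton) auto
    qed
    then show ?thesis
      using aff_dim_face_ge[where W = "{vec_of \<iota> coef}" and r = 1] by simp
  next
    case 3
    then obtain q where q: "positive_singletons m n a P = {q}"
      by (auto simp: card_1_singleton_iff)
    obtain l where l: "q = (l, n l)" "a (l, n l) > 0"
      using q in_positive_singletons_iff by (cases q) auto
    have cl: "coef (l, n l) = a (l, n l)"
      using q l in_positive_singletons_iff[of l "n l"] by (simp add: coef_def)
    have "\<alpha> \<in> span {vec_of \<iota> coef}" if \<alpha>: "normal_to_face \<alpha>" for \<alpha>
    proof -
      \<comment> \<open>As \<open>K\<close> is empty, \<open>coef\<close> is nonzero at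
        \<open>(l, n l)\<close> only, which fixes the factor.\<close>
      have "entry \<iota> \<alpha> (i, j) = entry \<iota> \<alpha> (l, n l) / a (l, n l) * coef (i, j)"
        if p: "(i, j) \<in> I" for i j
      proof (cases "i \<in> R")
        case iR: True
        then have i: "i \<in> singleton_rows m n" "i \<in> M"
          using 3 rows_subset by auto
        then have j: "j = n i"
          using p by (auto simp: singleton_rows_def index_eq_Sigma ckp_cols_def)
        show ?thesis
        proof (cases "i = l")
          case True
          then show ?thesis
            using l j cl by simp
        next
          case False
          then have "\<not> a (i, n i) > 0"
            using q l in_positive_singletons_iff[of i "n i"] iR i by simp
          then have "a (i, n i) = 0"
            using a_n_nonneg[OF i(2)] by simp
          then show ?thesis
            using normal_zero_weight[OF \<alpha> iR i(1)] j i(1) by (simp add: coef_def)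
        qed
      next
        case False
        then show ?thesis
          using normal_outside_rows[OF \<alpha> p] coef_outside_rows by simp
      qed
      then show ?thesis
        by (intro vec_of_in_span_singleton[where r = "entry \<iota> \<alpha> (l, n l) / a (l, n l)"]) auto
    qed
    then show ?thesis
      using aff_dim_face_ge[where W = "{vec_of \<iota> coef}" and r = 1] by simp
  qed
qed

lemma pack_rhs_pos:
  assumes "K \<noteq> {} \<or> positive_singletons m n a P \<noteq> {}"
  shows "pack_rhs m n a b P > 0"
proof (cases "K = {}")
  case True
  then obtain q where q: "q \<in> P" "a q > 0"
    using assms by (auto simp: positive_singletons_def)
  have "s > 0"
    using q a_nonneg P_subset by (intro sum_pos2[of _ q]) auto
  \<comment> \<open>With \<open>card K = 0\<close> the right-hand side is
    \<open>b - (b - s) = s\<close>.\<close>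
  then show ?thesis
    unfolding pack_rhs_def True by simp
next
  case False
  then have "real (card K) \<ge> 1"
    by (simp add: Suc_leI card_gt_0_iff)
  then have "(real (card K) - 1) * (b - s) \<ge> 0"
    using s_less_b by simp
  then show ?thesis
    using b_pos by (simp add: pack_rhs_def)
qed

text \<open>The origin lies in the polytope but not in \<open>F\<close>, so the dimension drops
  strictly. As \<open>F\<close> has dimension at least \<open>ckp_dim m n - 1\<close> and the
  polytope at most \<open>ckp_dim m n\<close>, the drop is exactly one.\<close>

lemma pack_face_facet_of:
  assumes "card K = 1 \<or> card (positive_singletons m n a P) = 1 \<or>
    K \<noteq> {} \<and> positive_singletons m n a P \<noteq> {}"
  shows "F facet_of ckp_polytope \<iota> m n a b"
proof -
  have "K \<noteq> {} \<or> positive_singletons m n a P \<noteq> {}"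
    using assms by (metis card.empty zero_neq_one)
  then have "0 \<notin> F"
    using pack_rhs_pos by (auto simp: pack_face_def pack_lhs_eq_inner)
  then have "F \<noteq> ckp_polytope \<iota> m n a b"
    using zero_in_polytope by auto
  then have "aff_dim F < aff_dim (ckp_polytope \<iota> m n a b)"
    by (intro face_of_aff_dim_lt pack_face_face_of) (simp_all add: ckp_polytope_def)
  moreover have "aff_dim (ckp_polytope \<iota> m n a b) \<le> int (ckp_dim m n)"
    using aff_dim_le_DIM[of "ckp_polytope \<iota> m n a b"] by (simp add: card_index)
  ultimately have "aff_dim F = aff_dim (ckp_polytope \<iota> m n a b) - 1"
    using aff_dim_face_codim_1[OF assms] by simp
  then show ?thesis
    using pack_face_face_of indicator_in_face by (auto simp: facet_of_def)
qed

end

text \<open>The side conditions exclude degenerate packs. With \<open>K\<close> empty, zero weights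
  reduce the inequality to \<open>0 \<le> 0\<close>, and two positive weights fix two coordinates at
  1. With two or more rows in \<open>K\<close> and no positive singleton, the face satisfies a
  separate equation for each row of \<open>K\<close>.\<close>

theorem theorem5:
  fixes \<iota> :: "'k::finite \<Rightarrow> nat \<times> nat"
    and m :: nat and n :: "nat \<Rightarrow> nat"
    and a :: "nat \<times> nat \<Rightarrow> real" and b :: real
    and P :: "(nat \<times> nat) set"
  assumes "bij_betw \<iota> UNIV (ckp_index m n)"
    and "\<forall>i\<in>ckp_rows m. n i \<ge> 1"
    and "ckp_rows m \<noteq> singleton_rows m n"
    and "(\<Sum>i\<in>ckp_rows m. Max ((\<lambda>j. a (i, j)) ` ckp_cols n i)) > b"
    and "b > 0"
    and "\<forall>p\<in>ckp_index m n. a p \<ge> 0"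
    and "\<forall>i\<in>ckp_rows m - singleton_rows m n. \<forall>j\<in>ckp_cols n i. \<forall>j'\<in>ckp_cols n i.
           j \<le> j' \<longrightarrow> a (i, j) \<ge> a (i, j')"
    and "is_pack m n a b P"
  shows "(\<forall>x\<in>ckp_polytope \<iota> m n a b. pack_lhs \<iota> m n a b P x \<le> pack_rhs m n a b P) \<and>
    (maximal_switching_pack m n a b P \<longrightarrow>
      pack_face \<iota> m n a b P face_of ckp_polytope \<iota> m n a b \<and>
      (rows_of m n P - singleton_rows m n \<noteq> {} \<or> (\<forall>p\<in>P. a p = 0) \<longrightarrow>
         aff_dim (pack_face \<iota> m n a b P)
           \<ge> int (ckp_dim m n) - int (card (rows_of m n P - singleton_rows m n))) \<and>
      (rows_of m n P \<inter> singleton_rows m n \<noteq> {} \<and>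
       (card (rows_of m n P - singleton_rows m n) = 1 \<or>
        card (positive_singletons m n a P) = 1 \<or>
        rows_of m n P - singleton_rows m n \<noteq> {} \<and> positive_singletons m n a P \<noteq> {}) \<longrightarrow>
         pack_face \<iota> m n a b P facet_of ckp_polytope \<iota> m n a b))"
proof -
  interpret complementarity_knapsack \<iota> m n a b P
    using assms by unfold_locales
  have ?thesis if "\<not> maximal_switching_pack m n a b P"
    using that pack_inequality_valid by (auto simp: pack_lhs_eq_inner)
  moreover have ?thesis if "maximal_switching_pack m n a b P"
  proof -
    interpret maximal_switching \<iota> m n a b P
      using that by unfold_locales
    show ?thesis
      using pack_inequality_valid pack_face_face_of aff_dim_face_general pack_face_facet_of
      by (simp add: pack_lhs_eq_inner)
  qed
  ultimately show ?thesis
    by blast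
qed

end
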